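(* Fix integers $k\ge 2$ and $J\ge 0$, and let $h^{(j)}_{i,l}(q)$ be the polynomials defined in the context. Let $j\ge J+1$ and $i,l\in\{1,\dots,k\}$, and write $h^{(j)}_{i,l}=\sum_{n\ge0}h^{(j)}_{i,l}(n)q^n$. If $k$ is odd and $l\not\equiv i\pmod 2$, then $h^{(j)}_{i,l}=0$; if $k$ is even and $j-J+l\not\equiv i\pmod 2$, then $h^{(j)}_{i,l}=0$. Otherwise, for every $n\ge 0$, $h^{(j)}_{i,l}(n)$ equals the number of partitions $\pi=(\pi_1,\dots,\pi_{\ell(\pi)})$ of $n$ such that: (1) $\pi_t-\pi_{t+k-1}\ge 2$ for all positive integers $t$ with $t+k-1\le\ell(\pi)$; (2) $\pi_1\le j$; (3) $m_j(\pi)\in\{l-2,l-1\}\cap\mathbb{N}$; (4) $\pi_{\ell(\pi)}>J$; (5) $m_{J+1}(\pi)\le k-i$; (6) for all positive integers $t$ with $t+k-2\le\ell(\pi)$, $\pi_t-\pi_{t+k-2}\le 1$ only if $\pi_t+\pi_{t+1}+\cdots+\pi_{t+k-2}\equiv (k-1)j+l-k\pmod 2$.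
   Context: $q$ is a formal variable. For fixed $k\ge 2$, $J\ge 0$ and $i\in\{1,\dots,k\}$, define polynomials $h^{(j)}_{i,l}(q)$ for $j\ge J$, $l\in\{1,\dots,k\}$ by $h^{(J)}_{i,l}=1$ if $l=i$ and $0$ otherwise, and for $j\ge J$: \[ h^{(j+1)}_{i,1}=\sum_{\substack{1\le t\le k\\ t\equiv k \ (\mathrm{mod}\ 2)}}h^{(j)}_{i,t},\qquad h^{(j+1)}_{i,l}=(1+q^{j+1})\,q^{(l-2)(j+1)}\sum_{\substack{1\le t\le k-l+1\\ t\equiv l+k+1\ (\mathrm{mod}\ 2)}}h^{(j)}_{i,t}\quad (2\le l\le k). \] A partition of $n$ is a nonincreasing finite sequence $\pi_1\ge\pi_2\ge\cdots\ge\pi_{\ell(\pi)}$ of positive integers summing to $n$ (the empty partition is the unique partition of $0$); $\ell(\pi)$ is its number of parts and $m_p(\pi)$ is the number of parts equal to $p$. $\mathbb{N}$ denotes the nonnegative integers. *)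

theory Defs
  imports "HOL-Computational_Algebra.Polynomial" "HOL-Number_Theory.Cong"
begin

text \<open>
  \<open>h_poly k J i j l\<close> is the polynomial \<open>h\<^sup>(\<^sup>j\<^sup>)\<close> with lower indices \<open>i, l\<close>; the variable \<open>q\<close> is
  the polynomial variable, so \<open>monom 1 m\<close> is \<open>q ^ m\<close>. Only \<open>J \<le> j\<close> and \<open>1 \<le> l \<le> k\<close> are
  meaningful; for \<open>j < J\<close> the initial value is returned by convention.
\<close>

primrec h_poly :: "nat \<Rightarrow> nat \<Rightarrow> nat \<Rightarrow> nat \<Rightarrow> nat \<Rightarrow> int poly" where
  "h_poly k J i 0 l = (if l = i then 1 else 0)"
| "h_poly k J i (Suc j) l =
    (if Suc j \<le> J then (if l = i then 1 else 0)
     else if l = 1 then \<Sum>t | 1 \<le> t \<and> t \<le> k \<and> [t = k] (mod 2). h_poly k J i j t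
     else (1 + monom 1 (j + 1)) * monom 1 ((l - 2) * (j + 1)) *
          (\<Sum>t | 1 \<le> t \<and> t \<le> k - l + 1 \<and> [t = l + k + 1] (mod 2). h_poly k J i j t))"

definition partition_of :: "nat \<Rightarrow> nat list \<Rightarrow> bool" where
  "partition_of n \<pi> \<longleftrightarrow> sorted_wrt (\<ge>) \<pi> \<and> (\<forall>p\<in>set \<pi>. 0 < p) \<and> sum_list \<pi> = n"

text \<open>Parts are numbered from 1; the value is meaningful only for \<open>1 \<le> t \<le> length \<pi>\<close>.\<close>

definition part :: "nat list \<Rightarrow> nat \<Rightarrow> nat" where
  "part \<pi> t = \<pi> ! (t - 1)"

text \<open>
  Conditions on the largest and on the smallest part hold vacuously for the empty partition.
  The differences of parts below are taken in \<open>nat\<close>; they do not truncate, as partitions are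
  nonincreasing.
\<close>

definition admissible :: "nat \<Rightarrow> nat \<Rightarrow> nat \<Rightarrow> nat \<Rightarrow> nat \<Rightarrow> nat list \<Rightarrow> bool" where
  "admissible k J i j l \<pi> \<longleftrightarrow>
     (\<forall>t\<ge>1. t + k - 1 \<le> length \<pi> \<longrightarrow> part \<pi> t - part \<pi> (t + k - 1) \<ge> 2) \<and>
     (\<pi> \<noteq> [] \<longrightarrow> part \<pi> 1 \<le> j) \<and>
     int (count_list \<pi> j) \<in> {int l - 2, int l - 1} \<and>
     (\<pi> \<noteq> [] \<longrightarrow> part \<pi> (length \<pi>) > J) \<and>
     count_list \<pi> (J + 1) \<le> k - i \<and>
     (\<forall>t\<ge>1. t + k - 2 \<le> length \<pi> \<longrightarrow> part \<pi> t - part \<pi> (t + k - 2) \<le> 1 \<longrightarrow>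
        [int (\<Sum>s = t..t + k - 2. part \<pi> s) = (int k - 1) * int j + int l - int k] (mod 2))"

text \<open>Hence cardinalities of sets of partitions of \<open>n\<close> are genuine counts.\<close>

lemma finite_partition_of: "finite {\<pi>. partition_of n \<pi>}"
proof (rule finite_subset)
  have len: "length \<pi> \<le> sum_list \<pi>" if "\<forall>p\<in>set \<pi>. 0 < p" for \<pi> :: "nat list"
    using that by (induction \<pi>) auto
  show "{\<pi>. partition_of n \<pi>} \<subseteq> {\<pi>. set \<pi> \<subseteq> {..n} \<and> length \<pi> \<le> n}"
    using len by (auto simp: partition_of_def intro: member_le_sum_list)
  show "finite {\<pi>. set \<pi> \<subseteq> {..n} \<and> length \<pi> \<le> n}"
    by (rule finite_lists_length_le) simp
qed

end

theory Submission
  imports Defs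
begin

text \<open>
  In terms of multiplicities \<open>f\<close>, condition (1) says \<open>f p + f (p + 1) < k\<close>, and condition (6)
  constrains the parity of \<open>p f p + (p + 1) f (p + 1)\<close> whenever \<open>f p + f (p + 1) = k - 1\<close>.
  Removing the \<open>m \<in> {l - 2, l - 1}\<close> parts equal to \<open>j + 1\<close> from a partition counted by
  \<open>h\<^sup>(\<^sup>j\<^sup>+\<^sup>1\<^sup>)\<close> with index \<open>l\<close> leaves a partition counted by \<open>h\<^sup>(\<^sup>j\<^sup>)\<close> with a unique index
  \<open>t \<le> k - l + 1\<close>, \<open>t \<equiv> l + k + 1\<close> (mod 2), and this is reversible, so the generating
  polynomials satisfy the recursion that defines \<open>h\<close>. The recursion starts at \<open>j = J\<close>, where only
  the empty partition with \<open>l = i\<close> is allowed.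
\<close>

section \<open>Windows of consecutive parts\<close>

lemma length_filter_two_values:
  fixes p :: nat
  shows "length (filter (\<lambda>x. x = p \<or> x = Suc p) xs) = count_list xs p + count_list xs (Suc p)"
  by (induction xs) auto

lemma sum_list_filter_two_values:
  fixes p :: nat
  shows "sum_list (filter (\<lambda>x. x = p \<or> x = Suc p) xs)
    = p * count_list xs p + Suc p * count_list xs (Suc p)"
  by (induction xs) auto

text \<open>In a nonincreasing list the entries \<open>p\<close> and \<open>Suc p\<close> form one
  contiguous block, which later serves as a window.\<close>

lemma sorted_split_two_values:
  fixes xs :: "nat list"
  assumes "sorted_wrt (\<ge>) xs"
  shows "xs = filter (\<lambda>x. x > Suc p) xs @ filter (\<lambda>x. x = p \<or> x = Suc p) xs
    @ filter (\<lambda>x. x < p) xs"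
  using assms
proof (induction xs)
  case (Cons x xs)
  then have le: "\<forall>y\<in>set xs. y \<le> x" and IH: "xs = filter (\<lambda>x. x > Suc p) xs
    @ filter (\<lambda>x. x = p \<or> x = Suc p) xs @ filter (\<lambda>x. x < p) xs" by auto
  consider "x > Suc p" | "x = p \<or> x = Suc p" | "x < p" by linarith
  then show ?case
  proof cases
    case 2
    then have "filter (\<lambda>x. x > Suc p) xs = []" using le by (auto simp: filter_empty_conv)
    then show ?thesis using 2 IH by auto
  next
    case 3
    then have "filter (\<lambda>x. x > Suc p) xs = []" "filter (\<lambda>x. x = p \<or> x = Suc p) xs = []"
      using le by (fastforce simp: filter_empty_conv)+
    then show ?thesis using 3 IH by auto
  qed (use IH in auto)
qed simp

lemma sorted_split_max:
  fixes xs :: "nat list"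
  assumes "sorted_wrt (\<ge>) xs" and "\<forall>x\<in>set xs. x \<le> m"
  shows "xs = replicate (count_list xs m) m @ filter (\<lambda>x. x \<noteq> m) xs"
  using assms
proof (induction xs)
  case (Cons x xs)
  show ?case
  proof (cases "x = m")
    case False
    then have "\<forall>y\<in>set xs. y \<noteq> m" using Cons.prems by fastforce
    then have "count_list xs m = 0" "filter (\<lambda>x. x \<noteq> m) xs = xs"
      by (auto simp: count_list_0_iff)
    then show ?thesis using False by simp
  qed (use Cons in auto)
qed simp

text \<open>A window whose ends differ by at most 1 contains only its last entry \<open>p\<close>
  and \<open>Suc p\<close>, so it fits into the block of these two values. If the multiplicities
  leave no room for more, window and block coincide, and the sum is known. Positions count from 0
  here, but from 1 in \<open>part\<close>. The lengths \<open>w = k\<close> and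
  \<open>w = k - 1\<close> serve conditions (1) and (6).\<close>

lemma window_imp_counts:
  fixes xs :: "nat list"
  assumes sorted: "sorted_wrt (\<ge>) xs" and "0 < w" and len: "t + w \<le> length xs"
    and spread: "xs ! t \<le> Suc (xs ! (t + w - 1))"
  defines "p \<equiv> xs ! (t + w - 1)"
  defines "win \<equiv> take w (drop t xs)"
  shows "w \<le> count_list xs p + count_list xs (Suc p)"
    and "count_list xs p + count_list xs (Suc p) = w \<Longrightarrow>
      sum_list win = p * count_list xs p + Suc p * count_list xs (Suc p)"
proof -
  define F where "F = filter (\<lambda>x. x = p \<or> x = Suc p)"
  have "x = p \<or> x = Suc p" if "x \<in> set win" for x
  proof -
    obtain s where s: "s < w" "x = xs ! (t + s)"
      using \<open>x \<in> set win\<close> len unfolding win_def by (auto simp: in_set_conv_nth)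
    have "xs ! (t + s) \<le> xs ! t"
      using sorted s len by (cases "s = 0") (auto simp: sorted_wrt_iff_nth_less)
    moreover have "xs ! (t + w - 1) \<le> xs ! (t + s)"
      using sorted s len by (cases "s = w - 1") (auto simp: sorted_wrt_iff_nth_less)
    ultimately show ?thesis using spread s unfolding p_def by linarith
  qed
  then have "F win = win" unfolding F_def by (simp add: filter_id_conv)
  moreover have "xs = take t xs @ win @ drop w (drop t xs)"
    unfolding win_def by (metis append_take_drop_id)
  ultimately have eq: "F xs = F (take t xs) @ win @ F (drop w (drop t xs))"
    unfolding F_def by (metis filter_append)
  have lw: "length win = w" using len by (simp add: win_def)
  have lF: "length (F xs) = count_list xs p + count_list xs (Suc p)"
    by (simp add: F_def length_filter_two_values)
  have lsum: "length (F xs) = length (F (take t xs)) + w + length (F (drop w (drop t xs)))"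
    by (subst eq) (simp add: lw)
  show "w \<le> count_list xs p + count_list xs (Suc p)" using lsum lF by linarith
  assume "count_list xs p + count_list xs (Suc p) = w"
  then have "F (take t xs) = []" "F (drop w (drop t xs)) = []" using lsum lF by auto
  then have "F xs = win" using eq by simp
  then show "sum_list win = p * count_list xs p + Suc p * count_list xs (Suc p)"
    using sum_list_filter_two_values[of p xs] by (simp add: F_def)
qed

text \<open>Converse direction: the window starts where the block of entries \<open>Suc p\<close>
  and \<open>p\<close> starts, right after the larger entries.\<close>

lemma counts_imp_window:
  fixes xs :: "nat list"
  assumes sorted: "sorted_wrt (\<ge>) xs" and "0 < w"
    and le: "w \<le> count_list xs p + count_list xs (Suc p)"
  obtains t where "t + w \<le> length xs" and "xs ! t \<le> Suc (xs ! (t + w - 1))"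
    and "count_list xs p + count_list xs (Suc p) = w \<Longrightarrow>
      sum_list (take w (drop t xs)) = p * count_list xs p + Suc p * count_list xs (Suc p)"
proof -
  define A where "A = filter (\<lambda>x. x > Suc p) xs"
  define F where "F = filter (\<lambda>x. x = p \<or> x = Suc p) xs"
  define B where "B = filter (\<lambda>x. x < p) xs"
  have xs: "xs = A @ F @ B"
    using sorted_split_two_values[OF sorted] unfolding A_def F_def B_def .
  have lF: "length F = count_list xs p + count_list xs (Suc p)"
    by (simp add: F_def length_filter_two_values)
  have nth: "xs ! (length A + s) = F ! s" if "s < w" for s
    using that le lF by (subst xs) (simp add: nth_append)
  have F: "F ! s = p \<or> F ! s = Suc p" if "s < w" for s
    using nth_mem[of s F] that le lF unfolding F_def by auto
  have "xs ! (length A) \<le> Suc (xs ! (length A + w - 1))"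
    using nth[of 0] nth[of "w - 1"] F[of 0] F[of "w - 1"] \<open>0 < w\<close> by auto
  moreover have "length A + w \<le> length xs" using le lF by (subst xs) simp
  moreover have "sum_list (take w (drop (length A) xs))
      = p * count_list xs p + Suc p * count_list xs (Suc p)"
    if "count_list xs p + count_list xs (Suc p) = w"
  proof -
    have "take w (drop (length A) xs) = F" using that lF by (subst xs) simp
    then show ?thesis by (simp add: F_def sum_list_filter_two_values)
  qed
  ultimately show thesis using that by blast
qed

section \<open>Admissibility in terms of multiplicities\<close>

text \<open>The range clause replaces the bounds on the first and last part. It also forces
  \<open>f J = 0\<close> and \<open>f (Suc j) = 0\<close>, so at \<open>p = J\<close> and
  \<open>p = j\<close> the pair reduces to one multiplicity.\<close>

definition freq_admissible :: "nat \<Rightarrow> nat \<Rightarrow> nat \<Rightarrow> nat \<Rightarrow> nat \<Rightarrow> (nat \<Rightarrow> nat) \<Rightarrow> bool" where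
  "freq_admissible k J i j l f \<longleftrightarrow>
     (\<forall>p. f p + f (Suc p) < k) \<and>
     (\<forall>p. 0 < f p \<longrightarrow> J < p \<and> p \<le> j) \<and>
     int (f j) \<in> {int l - 2, int l - 1} \<and>
     f (Suc J) \<le> k - i \<and>
     (\<forall>p. f p + f (Suc p) = k - 1 \<longrightarrow>
       [int (p * f p + Suc p * f (Suc p)) = (int k - 1) * int j + int l - int k] (mod 2))"

lemma sum_part_eq_sum_list:
  assumes "1 \<le> t" and "0 < w" and "t + w - 1 \<le> length xs"
  shows "(\<Sum>s = t..t + w - 1. part xs s) = sum_list (take w (drop (t - 1) xs))"
proof -
  have "sum_list (take w (drop (t - 1) xs)) = (\<Sum>s<w. xs ! (t - 1 + s))"
    using assms by (simp add: sum_list_sum_nth atLeast0LessThan)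
  also have "\<dots> = (\<Sum>s = t..t + w - 1. part xs s)"
    by (rule sum.reindex_bij_witness[where i = "\<lambda>s. s - t" and j = "\<lambda>s. t + s"])
      (use assms in \<open>auto simp: part_def\<close>)
  finally show ?thesis by simp
qed

lemma admissible_iff_freq:
  assumes k: "2 \<le> k" and part: "partition_of n xs"
  shows "admissible k J i j l xs \<longleftrightarrow> freq_admissible k J i j l (count_list xs)"
proof -
  let ?c = "count_list xs"
  have sorted: "sorted_wrt (\<ge>) xs" using part by (simp add: partition_of_def)
  have diff: "(\<forall>t\<ge>1. t + k - 1 \<le> length xs \<longrightarrow> part xs t - part xs (t + k - 1) \<ge> 2)
    \<longleftrightarrow> (\<forall>p. ?c p + ?c (Suc p) < k)" (is "?L \<longleftrightarrow> ?R")
  proof (intro iffI allI impI)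
    fix p assume L: ?L
    show "?c p + ?c (Suc p) < k"
    proof (rule ccontr)
      assume "\<not> ?c p + ?c (Suc p) < k"
      then obtain t where t: "t + k \<le> length xs" "xs ! t \<le> Suc (xs ! (t + k - 1))"
        using counts_imp_window[OF sorted, of k p] k by auto
      then show False using L[rule_format, of "Suc t"] by (simp add: part_def)
    qed
  next
    fix t assume R: ?R and t: "1 \<le> t" "t + k - 1 \<le> length xs"
    show "2 \<le> part xs t - part xs (t + k - 1)"
    proof (rule ccontr)
      assume "\<not> ?thesis"
      then have "xs ! (t - 1) \<le> Suc (xs ! (t - 1 + k - 1))" using t k by (simp add: part_def)
      moreover have "t - 1 + k \<le> length xs" using t k by linarith
      ultimately show False
        using window_imp_counts(1)[OF sorted, of k "t - 1"] R k by (metis not_le pos2 order_less_le_trans)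
    qed
  qed
  \<comment> \<open>The bound from condition (1) enters here: a window of \<open>k - 1\<close> parts
    \<open>p\<close> and \<open>Suc p\<close> contains all of them only because they occur at most
    \<open>k - 1\<close> times in total.\<close>
  have parity: "(\<forall>t\<ge>1. t + k - 2 \<le> length xs \<longrightarrow> part xs t - part xs (t + k - 2) \<le> 1 \<longrightarrow>
        [int (\<Sum>s = t..t + k - 2. part xs s) = c] (mod 2))
    \<longleftrightarrow> (\<forall>p. ?c p + ?c (Suc p) = k - 1 \<longrightarrow>
        [int (p * ?c p + Suc p * ?c (Suc p)) = c] (mod 2))" (is "?L \<longleftrightarrow> ?P")
    if R: "\<forall>p. ?c p + ?c (Suc p) < k" for c
  proof (intro iffI allI impI)
    fix p assume L: ?L and eq: "?c p + ?c (Suc p) = k - 1"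
    obtain t where t: "t + (k - 1) \<le> length xs" "xs ! t \<le> Suc (xs ! (t + (k - 1) - 1))"
      "sum_list (take (k - 1) (drop t xs)) = p * ?c p + Suc p * ?c (Suc p)"
      using counts_imp_window[OF sorted, of "k - 1" p] k eq by auto
    have ix: "Suc t + k - 2 = Suc t + (k - 1) - 1" using k by simp
    have "(\<Sum>s = Suc t..Suc t + k - 2. part xs s) = p * ?c p + Suc p * ?c (Suc p)"
      using sum_part_eq_sum_list[of "Suc t" "k - 1" xs] t k unfolding ix by simp
    moreover have "part xs (Suc t) - part xs (Suc t + k - 2) \<le> 1"
      using t(2) unfolding ix part_def by simp
    moreover have "Suc t + k - 2 \<le> length xs" using t k by simp
    ultimately show "[int (p * ?c p + Suc p * ?c (Suc p)) = c] (mod 2)"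
      using L[rule_format, of "Suc t"] by (metis le_add1 plus_1_eq_Suc)
  next
    fix t assume P: ?P and t: "1 \<le> t" "t + k - 2 \<le> length xs"
      and spread: "part xs t - part xs (t + k - 2) \<le> 1"
    have ix: "t + k - 2 = t + (k - 1) - 1" "t + k - 2 - 1 = t - 1 + (k - 1) - 1" using t k by auto
    define p where "p = xs ! (t - 1 + (k - 1) - 1)"
    have le: "xs ! (t - 1) \<le> Suc (xs ! (t - 1 + (k - 1) - 1))"
      using spread unfolding part_def ix(2) by linarith
    have len: "t - 1 + (k - 1) \<le> length xs" using t k by linarith
    note win = window_imp_counts[OF sorted _ len le, folded p_def]
    have eq: "?c p + ?c (Suc p) = k - 1" using win(1) R[rule_format, of p] k by linarith
    have "(\<Sum>s = t..t + k - 2. part xs s) = p * ?c p + Suc p * ?c (Suc p)"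
      unfolding ix(1) using win(2) eq k sum_part_eq_sum_list[of t "k - 1" xs] t by simp
    then show "[int (\<Sum>s = t..t + k - 2. part xs s) = c] (mod 2)" using P eq by simp
  qed
  have nth_bounds: "xs ! (length xs - 1) \<le> xs ! s \<and> xs ! s \<le> xs ! 0" if "s < length xs" for s
  proof
    show "xs ! (length xs - 1) \<le> xs ! s"
      using sorted that by (cases "s = length xs - 1") (auto simp: sorted_wrt_iff_nth_less)
    show "xs ! s \<le> xs ! 0"
      using sorted that by (cases "s = 0") (auto simp: sorted_wrt_iff_nth_less)
  qed
  have pos: "0 < ?c p \<longleftrightarrow> p \<in> set xs" for p using count_list_0_iff[of xs p] by auto
  have bounds: "(xs \<noteq> [] \<longrightarrow> part xs 1 \<le> j) \<and> (xs \<noteq> [] \<longrightarrow> part xs (length xs) > J)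
    \<longleftrightarrow> (\<forall>p. 0 < ?c p \<longrightarrow> J < p \<and> p \<le> j)"
  proof (cases "xs = []")
    case False
    then have ends: "xs ! 0 \<in> set xs" "xs ! (length xs - 1) \<in> set xs" by auto
    have "\<forall>p\<in>set xs. xs ! (length xs - 1) \<le> p \<and> p \<le> xs ! 0"
      using nth_bounds by (auto simp: in_set_conv_nth)
    then show ?thesis using ends False unfolding pos part_def
      by (auto intro: less_le_trans order_trans)
  qed simp
  show ?thesis
    unfolding admissible_def freq_admissible_def diff Suc_eq_plus1[of J, symmetric]
    using parity[where c = "(int k - 1) * int j + int l - int k"] bounds by argo
qed

section \<open>Removing the largest part\<close>

definition max_mults :: "nat \<Rightarrow> nat set" where
  "max_mults l = {m. int m \<in> {int l - 2, int l - 1}}"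

definition prev_indices :: "nat \<Rightarrow> nat \<Rightarrow> nat set" where
  "prev_indices k l = {t. 1 \<le> t \<and> t \<le> k - l + 1 \<and> [t = l + k + 1] (mod 2)}"

lemma cong_2_nat_iff: "[a = b] (mod 2) \<longleftrightarrow> even (a + b)" for a b :: nat
  unfolding cong_def by presburger

lemma cong_2_int_iff: "[a = b] (mod 2) \<longleftrightarrow> even (a + b)" for a b :: int
  unfolding cong_def by presburger

text \<open>Raising \<open>j\<close> adds \<open>k - 1\<close> to the target of condition (6), and
  replacing \<open>t\<close> by \<open>l\<close> adds \<open>l - t\<close>, which has the parity of
  \<open>k - 1\<close> by the congruence in \<open>prev_indices\<close>.\<close>

lemma target_parity:
  assumes "t \<in> prev_indices k l"
  shows "[x = (int k - 1) * int (Suc j) + int l - int k] (mod 2)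
    \<longleftrightarrow> [x = (int k - 1) * int j + int t - int k] (mod 2)"
proof -
  have "even (int t + int l + int k + 1)"
    using assms unfolding prev_indices_def cong_2_nat_iff by simp presburger
  moreover have "(int k - 1) * int (Suc j) = (int k - 1) * int j + int k - 1"
    by (simp add: algebra_simps)
  ultimately show ?thesis unfolding cong_2_int_iff by presburger
qed

text \<open>
  If \<open>t\<close> has the parity prescribed by \<open>prev_indices\<close>, then \<open>f j \<in> {t - 2, t - 1}\<close> determines \<open>t\<close>
  from \<open>f j\<close>, and \<open>t \<le> k - l + 1\<close> means \<open>f j \<le> k - l\<close>. The latter is what the conditions on
  \<open>f j + m\<close> amount to: for \<open>m = l - 2\<close> the value \<open>f j = k - l + 1\<close> is excluded by parity.
\<close>

lemma freq_admissible_Suc: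
  assumes k: "2 \<le> k" and J: "J < j" and l: "1 \<le> l" "l \<le> k" and supp: "f (Suc j) = 0"
  shows "freq_admissible k J i (Suc j) l (f(Suc j := m)) \<longleftrightarrow>
    m \<in> max_mults l \<and> (\<exists>t\<in>prev_indices k l. freq_admissible k J i j t f)"
    (is "?L \<longleftrightarrow> ?R")
proof
  let ?g = "f(Suc j := m)"
  let ?c = "(int k - 1) * int (Suc j) + int l - int k"
  assume L: ?L
  have lt: "?g p + ?g (Suc p) < k" for p using L by (simp add: freq_admissible_def)
  have bd: "0 < ?g p \<Longrightarrow> J < p \<and> p \<le> Suc j" for p using L unfolding freq_admissible_def by blast
  have m: "int m \<in> {int l - 2, int l - 1}" using L by (simp add: freq_admissible_def)
  have cJ: "f (Suc J) \<le> k - i" using L J by (simp add: freq_admissible_def)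
  have par: "?g p + ?g (Suc p) = k - 1 \<Longrightarrow>
      [int (p * ?g p + Suc p * ?g (Suc p)) = ?c] (mod 2)" for p
    using L unfolding freq_admissible_def by blast
  have ltj: "f j + m < k" using lt[of j] by simp
  have fj: "f j + l \<le> k"
  proof (rule ccontr)
    assume "\<not> f j + l \<le> k"
    \<comment> \<open>The pair at \<open>j\<close> then has sum \<open>j * (k - 1) + l - 2\<close>,
      while the target is \<open>j * (k - 1) + l - 1\<close>.\<close>
    then have ml: "int m = int l - 2" and eq: "f j + m = k - 1" using ltj m by auto
    have "[int (j * f j + Suc j * m) = ?c] (mod 2)" using par[of j] eq by simp
    moreover have "int (j * f j + Suc j * m) = int j * (int (f j + m)) + int m"
      by (simp add: algebra_simps)
    moreover have "int (f j + m) = int k - 1" using eq k by linarith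
    moreover have "?c = int j * (int k - 1) + int l - 1" by (simp add: algebra_simps)
    ultimately have "[int j * (int k - 1) + int m = int j * (int k - 1) + int l - 1] (mod 2)"
      by metis
    moreover have "int j * (int k - 1) + int m + (int j * (int k - 1) + int l - 1)
        = 2 * (int j * (int k - 1) + int m) + 1"
      using ml by simp
    ultimately have "even (2 * (int j * (int k - 1) + int m) + 1)"
      unfolding cong_2_int_iff by metis
    then show False by simp
  qed
  define t where "t = (if even (f j + k + l) then f j + 1 else f j + 2)"
  have t: "t \<in> prev_indices k l"
  proof -
    have "t \<le> k - l + 1"
    proof (cases "even (f j + k + l)")
      \<comment> \<open>Here \<open>f j + k + l\<close> is odd, so \<open>f j < k - l\<close>, and
        there is room for the larger candidate \<open>f j + 2\<close>.\<close>
      case False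
      then have "f j + l \<noteq> k" by auto
      then show ?thesis using fj False by (simp add: t_def)
    qed (use fj in \<open>simp add: t_def\<close>)
    then show ?thesis unfolding prev_indices_def cong_2_nat_iff t_def by auto
  qed
  have "freq_admissible k J i j t f"
    unfolding freq_admissible_def
  proof (intro conjI allI impI)
    fix p
    show "f p + f (Suc p) < k" using lt[of p] supp by (auto split: if_splits)
    {
      assume "0 < f p"
      then have "p \<noteq> Suc j" using supp by auto
      then have "J < p \<and> p \<le> Suc j" using bd[of p] \<open>0 < f p\<close> by simp
      then show "J < p" "p \<le> j" using \<open>p \<noteq> Suc j\<close> by auto
    }
    assume eq: "f p + f (Suc p) = k - 1"
    \<comment> \<open>Only pairs meeting \<open>Suc j\<close> could differ between \<open>f\<close>
      and \<open>?g\<close>. At \<open>p = Suc j\<close> the pair of \<open>f\<close> sums to 0,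
      which is less than \<open>k - 1\<close>; at \<open>p = j\<close> the bound \<open>ltj\<close>
      forces \<open>m = 0\<close>.\<close>
    have "p \<noteq> Suc j"
    proof
      assume p: "p = Suc j"
      then have "f (Suc (Suc j)) = 0" using bd[of "Suc (Suc j)"] by fastforce
      then show False using eq p supp k by simp
    qed
    moreover have "m = 0" if "p = j" using that eq supp ltj by simp
    ultimately have "?g p = f p" "?g (Suc p) = f (Suc p)" using supp by auto
    then have "[int (p * f p + Suc p * f (Suc p)) = ?c] (mod 2)" using par[of p] eq by simp
    then show "[int (p * f p + Suc p * f (Suc p)) = (int k - 1) * int j + int t - int k] (mod 2)"
      using target_parity[OF t] by blast
  qed (use cJ in \<open>auto simp: t_def\<close>)
  then show ?R using t m by (auto simp: max_mults_def)
next
  let ?g = "f(Suc j := m)"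
  let ?c = "(int k - 1) * int (Suc j) + int l - int k"
  assume ?R
  then obtain t where m: "int m \<in> {int l - 2, int l - 1}" and t: "t \<in> prev_indices k l"
    and adm: "freq_admissible k J i j t f" by (auto simp: max_mults_def)
  have "f j + 1 \<le> t" "1 \<le> t" "t \<le> k - l + 1"
    using adm t by (auto simp: freq_admissible_def prev_indices_def)
  then have fj: "f j + l \<le> k" using l by linarith
  have ml: "m + 1 \<le> l" using m by auto
  have lt: "f p + f (Suc p) < k" for p using adm by (simp add: freq_admissible_def)
  have bd: "0 < f p \<Longrightarrow> J < p \<and> p \<le> j" for p using adm unfolding freq_admissible_def by blast
  have f0: "f (Suc (Suc j)) = 0" using bd[of "Suc (Suc j)"] by fastforce
  show ?L
    unfolding freq_admissible_def
  proof (intro conjI allI impI)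
    fix p
    show "?g p + ?g (Suc p) < k" using lt[of p] f0 fj ml l by auto
    {
      assume "0 < ?g p"
      then show "J < p" "p \<le> Suc j" using bd[of p] J by (auto split: if_splits)
    }
    assume eq: "?g p + ?g (Suc p) = k - 1"
    \<comment> \<open>In the first two cases the bounds force \<open>l = m + 1\<close>, and the sum
      equals the target exactly. In the last case the update does not touch the pair, and
      \<open>target_parity\<close> transfers the congruence.\<close>
    consider "p = Suc j" | "p = j" | "p \<noteq> j" "p \<noteq> Suc j" by blast
    then show "[int (p * ?g p + Suc p * ?g (Suc p)) = ?c] (mod 2)"
    proof cases
      case 1
      then have "int k = int m + 1" "l = k" using eq f0 ml l k by auto
      then have "int (p * ?g p + Suc p * ?g (Suc p)) = ?c" using 1 f0
        by (simp add: algebra_simps)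
      then show ?thesis by simp
    next
      case 2
      then have "int l = int m + 1" "int k = int m + 1 + int (f j)" using eq fj ml l by auto
      then have "int (p * ?g p + Suc p * ?g (Suc p)) = ?c" using 2
        by (simp add: algebra_simps)
      then show ?thesis by simp
    next
      case 3
      then show ?thesis using eq adm target_parity[OF t] by (simp add: freq_admissible_def)
    qed
  qed (use m J adm in \<open>auto simp: freq_admissible_def\<close>)
qed

text \<open>Start of the recursion: below the parts \<open>Suc J\<close> there is only the empty
  partition, with index \<open>i\<close>. Condition (5) yields \<open>l \<le> k - i + 2\<close>, and
  parity rules out equality, which leaves \<open>i \<le> k - l + 1\<close>.\<close>

lemma freq_admissible_base:
  assumes k: "2 \<le> k" and l: "1 \<le> l" "l \<le> k" and i: "1 \<le> i" "i \<le> k"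
    and parity: "even (i + l + k + 1)"
  shows "freq_admissible k J i (Suc J) l ((\<lambda>_. 0)(Suc J := m)) \<longleftrightarrow>
    m \<in> max_mults l \<and> i \<in> prev_indices k l"
    (is "?L \<longleftrightarrow> ?R")
proof
  assume ?L
  then have m: "int m \<in> {int l - 2, int l - 1}" and "m \<le> k - i"
    by (auto simp: freq_admissible_def)
  then have "l \<le> k - i + 2" using i by auto
  moreover have "l \<noteq> k - i + 2"
  proof
    assume "l = k - i + 2"
    then have "l + i = k + 2" using i by simp
    then show False using parity by presburger
  qed
  ultimately have "i \<le> k - l + 1" using l i by linarith
  then show ?R using m parity i unfolding max_mults_def prev_indices_def cong_2_nat_iff
    by (simp add: add.assoc)
next
  assume ?R
  then have m: "int m \<in> {int l - 2, int l - 1}" and "i \<le> k - l + 1"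
    by (auto simp: max_mults_def prev_indices_def)
  moreover have "m + 1 \<le> l" using m by auto
  ultimately have ml: "m + i \<le> k" "m < k" "m = k - 1 \<longrightarrow> l = k" using l i by auto
  show ?L
    unfolding freq_admissible_def
  proof (intro conjI allI impI)
    fix p
    let ?g = "(\<lambda>_. 0)(Suc J := m)"
    assume "?g p + ?g (Suc p) = k - 1"
    then have "m = k - 1" and "int k = int m + 1" and "p = Suc J \<or> p = J" using k
      by (auto split: if_splits)
    then have "int (p * ?g p + Suc p * ?g (Suc p)) = (int k - 1) * int (Suc J) + int l - int k"
      using ml(3) by (auto simp: algebra_simps simp del: of_nat_diff)
    then show "[int (p * ?g p + Suc p * ?g (Suc p)) = (int k - 1) * int (Suc J) + int l - int k] (mod 2)"
      by simp
  qed (use m ml k in \<open>auto split: if_splits\<close>)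
qed

section \<open>The bijection behind the recursion\<close>

text \<open>The case \<open>j = J\<close> is set by convention: for \<open>2 \<le> k\<close>,
  \<open>admissible\<close> would accept the empty partition there for \<open>l = 1\<close> and
  \<open>l = 2\<close> instead of \<open>l = i\<close>. The size of \<open>\<pi>\<close> is left
  free.\<close>

definition part_sets :: "nat \<Rightarrow> nat \<Rightarrow> nat \<Rightarrow> nat \<Rightarrow> nat \<Rightarrow> nat list set" where
  "part_sets k J i j l =
    (if j \<le> J then if l = i then {[]} else {}
     else {\<pi>. partition_of (sum_list \<pi>) \<pi> \<and> admissible k J i j l \<pi>})"

lemma part_sets_freq:
  assumes "2 \<le> k" and "J < j"
  shows "\<pi> \<in> part_sets k J i j l \<longleftrightarrow>
    partition_of (sum_list \<pi>) \<pi> \<and> freq_admissible k J i j l (count_list \<pi>)"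
  using assms admissible_iff_freq by (auto simp: part_sets_def)

lemma part_sets_bounds:
  assumes "2 \<le> k" and "\<pi> \<in> part_sets k J i j l"
  shows "partition_of (sum_list \<pi>) \<pi>" and "\<forall>x\<in>set \<pi>. x \<le> j"
proof -
  show "partition_of (sum_list \<pi>) \<pi>"
    using assms(2) by (auto simp: part_sets_def partition_of_def split: if_splits)
  show "\<forall>x\<in>set \<pi>. x \<le> j"
  proof (cases "J < j")
    case True
    then have "0 < count_list \<pi> x \<Longrightarrow> x \<le> j" for x
      using part_sets_freq[OF assms(1) True] assms(2) unfolding freq_admissible_def by blast
    then show ?thesis by (metis count_list_0_iff gr0I)
  qed (use assms in \<open>auto simp: part_sets_def split: if_splits\<close>)
qed

lemma count_list_replicate_append:
  assumes "\<forall>x\<in>set \<pi>. x \<le> j"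
  shows "count_list (replicate m (Suc j) @ \<pi>) = (count_list \<pi>)(Suc j := m)"
proof -
  have "count_list (replicate m (Suc j)) = (\<lambda>_. 0)(Suc j := m)" by (induction m) auto
  moreover have "count_list \<pi> (Suc j) = 0" using assms by (force simp: count_list_0_iff)
  ultimately show ?thesis by auto
qed

lemma part_sets_Suc_iff:
  assumes k: "2 \<le> k" and J: "J \<le> j" and l: "1 \<le> l" "l \<le> k" and i: "1 \<le> i" "i \<le> k"
    and parity: "even ((k + 1) * (Suc j - J) + l + i)"
    and part: "partition_of (sum_list \<pi>) \<pi>" and bd: "\<forall>x\<in>set \<pi>. x \<le> j"
  shows "replicate m (Suc j) @ \<pi> \<in> part_sets k J i (Suc j) l \<longleftrightarrow>
    m \<in> max_mults l \<and> (\<exists>t\<in>prev_indices k l. \<pi> \<in> part_sets k J i j t)"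
proof -
  let ?\<pi> = "replicate m (Suc j) @ \<pi>"
  have "partition_of (sum_list ?\<pi>) ?\<pi>"
    using part bd le_SucI by (auto simp: partition_of_def sorted_wrt_append sorted_wrt_iff_nth_less[of _ "replicate _ _"])
  then have L: "?\<pi> \<in> part_sets k J i (Suc j) l
      \<longleftrightarrow> freq_admissible k J i (Suc j) l ((count_list \<pi>)(Suc j := m))"
    using J by (simp add: part_sets_freq[OF k] count_list_replicate_append[OF bd])
  have c0: "count_list \<pi> (Suc j) = 0" using bd by (force simp: count_list_0_iff)
  show ?thesis
  proof (cases "J = j")
    case True
    show ?thesis
    proof (cases "\<pi> = []")
      case True
      then have "count_list \<pi> = (\<lambda>_. 0)" by auto
      moreover have "even (i + l + k + 1)" using parity \<open>J = j\<close> by (simp add: Suc_diff_le) presburger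
      ultimately show ?thesis
        using L True \<open>J = j\<close> freq_admissible_base[OF k l i] by (auto simp: part_sets_def)
    next
      case False
      \<comment> \<open>With \<open>J = j\<close>, a nonempty \<open>\<pi>\<close> has a part at
        most \<open>J\<close>, which is inadmissible on the left, while the right side allows only
        \<open>[]\<close>.\<close>
      then obtain x where "x \<in> set \<pi>" by (meson list.set_sel(1))
      then have "0 < ((count_list \<pi>)(Suc j := m)) x" "x \<le> J"
        using bd \<open>J = j\<close> by (auto simp: count_list_0_iff intro!: gr0I)
      then have "\<not> freq_admissible k J i (Suc j) l ((count_list \<pi>)(Suc j := m))"
        unfolding freq_admissible_def by (meson not_le)
      then show ?thesis using L False \<open>J = j\<close> by (auto simp: part_sets_def split: if_splits)
    qed
  next
    case False
    then have "J < j" using J by simp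
    then show ?thesis
      using L freq_admissible_Suc[where f = "count_list \<pi>", OF k _ l c0] part
      by (simp add: part_sets_freq[OF k])
  qed
qed

text \<open>For \<open>J < j\<close> the multiplicity of \<open>j\<close> leaves two consecutive
  candidates for the index, and all elements of \<open>prev_indices k l\<close> have the same
  parity. So the sum over \<open>t\<close> counts no partition twice.\<close>

lemma part_sets_index_unique:
  assumes k: "2 \<le> k" and "\<pi> \<in> part_sets k J i j t" and "\<pi> \<in> part_sets k J i j t'"
    and "t \<in> prev_indices k l" and "t' \<in> prev_indices k l"
  shows "t = t'"
proof (cases "J < j")
  case True
  then have "int (count_list \<pi> j) \<in> {int t - 2, int t - 1} \<inter> {int t' - 2, int t' - 1}"
    using assms by (auto simp: part_sets_freq freq_admissible_def)
  moreover have "even (t + t')"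
    using assms(4,5) unfolding prev_indices_def cong_2_nat_iff by simp
  ultimately show ?thesis by (auto; presburger)
qed (use assms in \<open>auto simp: part_sets_def split: if_splits\<close>)

text \<open>The recursion in bijective form: \<open>m\<close> accounts for the prefactor and
  \<open>t\<close> is the summation index. The image does not show \<open>t\<close>; injectivity
  recovers it by \<open>part_sets_index_unique\<close>.\<close>

lemma bij_betw_part_sets_Suc:
  assumes k: "2 \<le> k" and J: "J \<le> j" and l: "1 \<le> l" "l \<le> k" and i: "1 \<le> i" "i \<le> k"
    and parity: "even ((k + 1) * (Suc j - J) + l + i)"
  shows "bij_betw (\<lambda>(m, t, \<pi>). replicate m (Suc j) @ \<pi>)
    (max_mults l \<times> Sigma (prev_indices k l) (part_sets k J i j))
    (part_sets k J i (Suc j) l)" (is "bij_betw ?F ?A ?B")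
proof (rule bij_betw_imageI)
  show "inj_on ?F ?A"
  proof (rule inj_onI)
    fix a b assume "a \<in> ?A" "b \<in> ?A" "?F a = ?F b"
    then obtain m t \<pi> m' t' \<pi>' where ab: "a = (m, t, \<pi>)" "b = (m', t', \<pi>')"
      and t: "t \<in> prev_indices k l" "t' \<in> prev_indices k l"
      and \<pi>: "\<pi> \<in> part_sets k J i j t" "\<pi>' \<in> part_sets k J i j t'"
      and eq: "replicate m (Suc j) @ \<pi> = replicate m' (Suc j) @ \<pi>'"
      by (cases a, cases b) auto
    have "count_list (replicate m (Suc j) @ \<pi>) (Suc j) = m"
      "count_list (replicate m' (Suc j) @ \<pi>') (Suc j) = m'"
      using \<pi>[THEN part_sets_bounds(2)[OF k]] by (simp_all only: count_list_replicate_append fun_upd_same)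
    then have "m = m'" using eq by simp
    then have "\<pi> = \<pi>'" using eq by simp
    then show "a = b"
      unfolding ab using \<open>m = m'\<close> part_sets_index_unique[OF k] \<pi> t by blast
  qed
  show "?F ` ?A = ?B"
  proof (intro equalityI subsetI)
    fix \<rho> assume "\<rho> \<in> ?F ` ?A"
    then obtain m t \<pi> where "\<rho> = replicate m (Suc j) @ \<pi>" "m \<in> max_mults l"
      "t \<in> prev_indices k l" "\<pi> \<in> part_sets k J i j t" by auto
    then show "\<rho> \<in> ?B"
      using part_sets_Suc_iff[OF assms part_sets_bounds[OF k]] by blast
  next
    fix \<rho> assume \<rho>: "\<rho> \<in> ?B"
    define m where "m = count_list \<rho> (Suc j)"
    define \<pi> where "\<pi> = filter (\<lambda>x. x \<noteq> Suc j) \<rho>"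
    note bounds = part_sets_bounds[OF k \<rho>]
    have eq: "\<rho> = replicate m (Suc j) @ \<pi>"
      unfolding m_def \<pi>_def using bounds by (intro sorted_split_max) (auto simp: partition_of_def)
    have "partition_of (sum_list \<pi>) \<pi>" "\<forall>x\<in>set \<pi>. x \<le> j"
      using bounds unfolding \<pi>_def by (auto simp: partition_of_def sorted_wrt_filter le_Suc_eq)
    then obtain t where "m \<in> max_mults l" "t \<in> prev_indices k l" "\<pi> \<in> part_sets k J i j t"
      using part_sets_Suc_iff[OF assms] \<rho> unfolding eq by blast
    then show "\<rho> \<in> ?F ` ?A" using eq by (intro image_eqI[of _ _ "(m, t, \<pi>)"]) auto
  qed
qed

section \<open>Generating polynomials\<close>

lemma finite_max_mults: "finite (max_mults l)"
  by (rule finite_subset[of _ "{..l}"]) (auto simp: max_mults_def)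

lemma finite_prev_indices: "finite (prev_indices k l)"
  by (rule finite_subset[of _ "{..k - l + 1}"]) (auto simp: prev_indices_def)

text \<open>The prefactor of the recursion is the generating polynomial for the multiplicity of
  \<open>Suc j\<close>. For \<open>l = 1\<close> this multiplicity is 0 and
  \<open>prev_indices k 1\<close> is the index set of the separate clause, so both clauses take one
  form.\<close>

lemma h_poly_Suc:
  assumes "J \<le> j" and "1 \<le> l" and "l \<le> k"
  shows "h_poly k J i (Suc j) l =
    (\<Sum>m\<in>max_mults l. monom 1 (m * Suc j)) * (\<Sum>t\<in>prev_indices k l. h_poly k J i j t)"
proof (cases "l = 1")
  case True
  have "max_mults l = {0}" using True by (auto simp: max_mults_def)
  moreover have "prev_indices k l = {t. 1 \<le> t \<and> t \<le> k \<and> [t = k] (mod 2)}"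
    using True assms unfolding prev_indices_def cong_2_nat_iff by auto
  ultimately show ?thesis using assms True by simp
next
  case False
  then obtain d where d: "l = d + 2" using assms by (metis add.commute le_Suc_ex le_neq_implies_less Suc_leI nat_1_add_1 plus_1_eq_Suc)
  then have "max_mults l = {d, d + 1}" by (auto simp: max_mults_def)
  then have "(\<Sum>m\<in>max_mults l. monom 1 (m * Suc j)) =
      (1 + monom 1 (j + 1)) * monom (1::int) ((l - 2) * (j + 1))"
    using d by (simp add: algebra_simps mult_monom)
  then show ?thesis using assms d by (simp add: prev_indices_def)
qed

text \<open>For odd \<open>k\<close> the parity test compares \<open>l\<close> with
  \<open>i\<close>, for even \<open>k\<close> it compares \<open>j - J + l\<close> with
  \<open>i\<close>. Finiteness is part of the induction because a sum over an infinite set is 0 by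
  default.\<close>

lemma h_poly_generating_function:
  assumes k: "2 \<le> k" and i: "1 \<le> i" "i \<le> k" and J: "J \<le> j" and l: "1 \<le> l" "l \<le> k"
  shows "if even ((k + 1) * (j - J) + l + i)
    then finite (part_sets k J i j l) \<and>
      h_poly k J i j l = (\<Sum>\<pi>\<in>part_sets k J i j l. monom 1 (sum_list \<pi>))
    else h_poly k J i j l = 0"
  using J l
proof (induction j arbitrary: l rule: dec_induct)
  case base
  have "h_poly k J i J l = (if l = i then 1 else 0)" by (cases J) auto
  then show ?case by (auto simp: part_sets_def)
next
  case (step j)
  \<comment> \<open>The congruence for \<open>t\<close> absorbs the growth of
    \<open>(k + 1) * (j - J)\<close> by \<open>k + 1\<close>, so the test has the same outcome for
    \<open>j\<close>, \<open>t\<close> as for \<open>Suc j\<close>, \<open>l\<close>, and vanishing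
    propagates.\<close>
  have prev: "1 \<le> t \<and> t \<le> k \<and>
      (even ((k + 1) * (j - J) + t + i) \<longleftrightarrow> even ((k + 1) * (Suc j - J) + l + i))"
    if "t \<in> prev_indices k l" for t
  proof -
    have "even (t + l + k + 1)"
      using that unfolding prev_indices_def cong_2_nat_iff by (simp add: add.assoc)
    moreover have "(k + 1) * (Suc j - J) = (k + 1) * (j - J) + k + 1"
      using step.hyps by (simp add: Suc_diff_le)
    ultimately show ?thesis using that step.prems unfolding prev_indices_def
      by (auto simp del: mult_Suc_right)
  qed
  show ?case
  proof (cases "even ((k + 1) * (Suc j - J) + l + i)")
    case False
    then have "h_poly k J i j t = 0" if "t \<in> prev_indices k l" for t
      using step.IH[of t] prev[OF that] by auto
    then have "h_poly k J i (Suc j) l = 0"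
      using h_poly_Suc[OF step.hyps(1) step.prems] by simp
    then show ?thesis using False by simp
  next
    case True
    let ?P = "part_sets k J i j" and ?T = "prev_indices k l" and ?M = "max_mults l"
    have IH: "finite (?P t)" "h_poly k J i j t = (\<Sum>\<pi>\<in>?P t. monom 1 (sum_list \<pi>))"
      if "t \<in> ?T" for t
      using step.IH[of t] prev[OF that] True by auto
    note bij = bij_betw_part_sets_Suc[OF k step.hyps(1) step.prems i True]
    have "finite (?M \<times> Sigma ?T ?P)"
      using IH(1) by (intro finite_cartesian_product finite_SigmaI finite_max_mults
          finite_prev_indices)
    then have fin: "finite (part_sets k J i (Suc j) l)" using bij bij_betw_finite by blast
    have "h_poly k J i (Suc j) l = (\<Sum>m\<in>?M. monom 1 (m * Suc j)) *
        (\<Sum>t\<in>?T. \<Sum>\<pi>\<in>?P t. monom 1 (sum_list \<pi>))"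
      using IH(2) by (simp only: h_poly_Suc[OF step.hyps(1) step.prems] cong: sum.cong)
    also have "\<dots> = (\<Sum>m\<in>?M. monom 1 (m * Suc j)) *
        (\<Sum>(t, \<pi>)\<in>Sigma ?T ?P. monom 1 (sum_list \<pi>))"
      using IH(1) by (simp add: sum.Sigma finite_prev_indices)
    also have "\<dots> = (\<Sum>(m, t, \<pi>)\<in>?M \<times> Sigma ?T ?P.
        monom 1 (sum_list (replicate m (Suc j) @ \<pi>)))"
      unfolding sum_product sum.cartesian_product
      by (intro sum.cong refl) (auto simp: mult_monom sum_list_replicate)
    also have "\<dots> = (\<Sum>\<pi>\<in>part_sets k J i (Suc j) l. monom 1 (sum_list \<pi>))"
      by (subst sum.reindex_bij_betw[OF bij, symmetric]) (simp add: case_prod_unfold)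
    finally show ?thesis using fin True by simp
  qed
qed

theorem theorem7p1:
  fixes k J i j l :: nat
  assumes "k \<ge> 2" and "j \<ge> J + 1" and "i \<in> {1..k}" and "l \<in> {1..k}"
  shows "(odd k \<and> [l \<noteq> i] (mod 2) \<longrightarrow> h_poly k J i j l = 0) \<and>
         (even k \<and> [j - J + l \<noteq> i] (mod 2) \<longrightarrow> h_poly k J i j l = 0) \<and>
         (\<not> (odd k \<and> [l \<noteq> i] (mod 2)) \<and> \<not> (even k \<and> [j - J + l \<noteq> i] (mod 2)) \<longrightarrow>
           (\<forall>n. coeff (h_poly k J i j l) n =
                 int (card {\<pi>. partition_of n \<pi> \<and> admissible k J i j l \<pi>})))"
proof -
  let ?P = "part_sets k J i j l"
  have gf: "if even ((k + 1) * (j - J) + l + i)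
    then finite ?P \<and> h_poly k J i j l = (\<Sum>\<pi>\<in>?P. monom 1 (sum_list \<pi>))
    else h_poly k J i j l = 0"
    using h_poly_generating_function assms by simp
  have parity: "even ((k + 1) * (j - J) + l + i) \<longleftrightarrow>
      \<not> (odd k \<and> [l \<noteq> i] (mod 2)) \<and> \<not> (even k \<and> [j - J + l \<noteq> i] (mod 2))"
    unfolding cong_2_nat_iff by auto
  have "coeff (h_poly k J i j l) n = int (card {\<pi>. partition_of n \<pi> \<and> admissible k J i j l \<pi>})"
    if "even ((k + 1) * (j - J) + l + i)" for n
  proof -
    have "coeff (h_poly k J i j l) n = (\<Sum>\<pi>\<in>?P. if sum_list \<pi> = n then 1 else 0)"
      using gf that by (simp add: coeff_sum)
    also have "\<dots> = int (card {\<pi> \<in> ?P. sum_list \<pi> = n})"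
      using gf that by (simp add: sum.If_cases Int_def)
    \<comment> \<open>Since \<open>J < j\<close>, \<open>?P\<close> is not the conventional initial
      set but consists of the admissible partitions of every size.\<close>
    also have "{\<pi> \<in> ?P. sum_list \<pi> = n} = {\<pi>. partition_of n \<pi> \<and> admissible k J i j l \<pi>}"
      using assms(2) by (auto simp: part_sets_def partition_of_def)
    finally show ?thesis .
  qed
  then show ?thesis using gf parity by (cases "even ((k + 1) * (j - J) + l + i)") auto
qed

end
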